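(* Let $(G,\sigma)$ and $(H,\pi)$ be signed graphs and let $\phi$ be a graph homomorphism of $G$ to $H$. Then $\phi$ is a homomorphism of signed graphs from $(G,\sigma)$ to $(H,\pi)$ (i.e. it preserves the signs of closed walks) if and only if there is a switching $(G,\sigma')$ of $(G,\sigma)$ such that $\phi$ is an edge-sign-preserving homomorphism from $(G,\sigma')$ to $(H,\pi)$.
   Context: Graphs may have loops and multiple edges; each edge has a multiset of two endpoints. A graph homomorphism of $G$ to $H$ maps vertices of $G$ to vertices of $H$ and edges of $G$ to edges of $H$ and preserves incidence: an edge with endpoints $u,v$ is mapped to an edge whose endpoints are the images of $u$ and $v$. A signed graph $(G,\sigma)$ is a graph with a map $\sigma:E(G)\to\{+,-\}$. The sign of a walk is the product of the signs of its edges, counted with repetition. Switching a set $X\subseteq V(G)$ negates the signs of all edges with one endpoint in $X$ and the other in $V(G)\setminus X$; a switching of $(G,\sigma)$ is any signed graph $(G,\sigma')$ obtained this way. A homomorphism of signed graphs $(G,\sigma)\to(H,\pi)$ is a graph homomorphism of $G$ to $H$ that preserves the signs of closed walks: each closed walk of $(G,\sigma)$ has the same sign as its image in $(H,\pi)$. An edge-sign-preserving homomorphism of $(G,\sigma)$ to $(H,\pi)$ is a graph homomorphism of $G$ to $H$ such that each edge has the same sign as its image. *)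

theory Defs
  imports "HOL-Library.Multiset"
begin

datatype sign = Pos | Neg

instantiation sign :: "{comm_monoid_mult, uminus}"
begin

definition one_sign :: sign where
  "1 = Pos"

definition times_sign :: "sign \<Rightarrow> sign \<Rightarrow> sign" where
  "s * t = (if s = t then Pos else Neg)"

definition uminus_sign :: "sign \<Rightarrow> sign" where
  "- s = (case s of Pos \<Rightarrow> Neg | Neg \<Rightarrow> Pos)"

instance
proof
  fix a b c :: sign
  show "a * b * c = a * (b * c)"
    by (cases a; cases b; cases c) (simp_all add: times_sign_def)
  show "a * b = b * a"
    by (simp add: times_sign_def)
  show "1 * a = a"
    by (cases a) (simp_all add: times_sign_def one_sign_def)
qed

end

text \<open>Graphs may be infinite; a loop at \<open>v\<close> has endpoint multiset \<open>{#v, v#}\<close>.\<close>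

record ('v, 'e) mgraph =
  verts :: "'v set"
  edges :: "'e set"
  ends :: "'e \<Rightarrow> 'v multiset"

definition multigraph :: "('v, 'e) mgraph \<Rightarrow> bool" where
  "multigraph G \<longleftrightarrow>
     (\<forall>e\<in>edges G. size (ends G e) = 2 \<and> set_mset (ends G e) \<subseteq> verts G)"

text \<open>A map between graphs is a pair: its vertex part and its edge part.\<close>

type_synonym ('v, 'e, 'w, 'f) graph_map = "('v \<Rightarrow> 'w) \<times> ('e \<Rightarrow> 'f)"

definition graph_hom ::
    "('v, 'e) mgraph \<Rightarrow> ('w, 'f) mgraph \<Rightarrow> ('v, 'e, 'w, 'f) graph_map \<Rightarrow> bool" where
  "graph_hom G H \<phi> \<longleftrightarrow>
     (\<forall>v\<in>verts G. fst \<phi> v \<in> verts H) \<and>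
     (\<forall>e\<in>edges G. snd \<phi> e \<in> edges H) \<and>
     (\<forall>e\<in>edges G. ends H (snd \<phi> e) = image_mset (fst \<phi>) (ends G e))"

text \<open>A walk \<open>v\<^sub>0 e\<^sub>1 v\<^sub>1 \<dots> e\<^sub>k v\<^sub>k\<close> is the pair of its vertex list
  \<open>[v\<^sub>0, \<dots>, v\<^sub>k]\<close> and its edge list \<open>[e\<^sub>1, \<dots>, e\<^sub>k]\<close>; \<open>k = 0\<close> is allowed.\<close>

type_synonym ('v, 'e) walk = "'v list \<times> 'e list"

definition is_walk :: "('v, 'e) mgraph \<Rightarrow> ('v, 'e) walk \<Rightarrow> bool" where
  "is_walk G W \<longleftrightarrow>
     length (fst W) = Suc (length (snd W)) \<and>
     set (fst W) \<subseteq> verts G \<and> set (snd W) \<subseteq> edges G \<and>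
     (\<forall>i<length (snd W). ends G (snd W ! i) = {#fst W ! i, fst W ! Suc i#})"

definition closed_walk :: "('v, 'e) mgraph \<Rightarrow> ('v, 'e) walk \<Rightarrow> bool" where
  "closed_walk G W \<longleftrightarrow> is_walk G W \<and> hd (fst W) = last (fst W)"

definition walk_image ::
    "('v, 'e, 'w, 'f) graph_map \<Rightarrow> ('v, 'e) walk \<Rightarrow> ('w, 'f) walk" where
  "walk_image \<phi> W = (map (fst \<phi>) (fst W), map (snd \<phi>) (snd W))"

text \<open>A signed graph is a graph \<open>G\<close> together with a signature \<open>\<sigma>\<close>, of which only the
  values on \<open>edges G\<close> matter.\<close>

definition walk_sign :: "('e \<Rightarrow> sign) \<Rightarrow> ('v, 'e) walk \<Rightarrow> sign" where
  "walk_sign \<sigma> W = prod_list (map \<sigma> (snd W))"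

definition switch ::
    "('v, 'e) mgraph \<Rightarrow> 'v set \<Rightarrow> ('e \<Rightarrow> sign) \<Rightarrow> 'e \<Rightarrow> sign" where
  "switch G X \<sigma> e =
     (if \<exists>u v. ends G e = {#u, v#} \<and> u \<in> X \<and> v \<in> verts G - X then - \<sigma> e else \<sigma> e)"

definition is_switching ::
    "('v, 'e) mgraph \<Rightarrow> ('e \<Rightarrow> sign) \<Rightarrow> ('e \<Rightarrow> sign) \<Rightarrow> bool" where
  "is_switching G \<sigma> \<sigma>' \<longleftrightarrow>
     (\<exists>X\<subseteq>verts G. \<forall>e\<in>edges G. \<sigma>' e = switch G X \<sigma> e)"

definition signed_graph_hom ::
    "('v, 'e) mgraph \<Rightarrow> ('e \<Rightarrow> sign) \<Rightarrow> ('w, 'f) mgraph \<Rightarrow> ('f \<Rightarrow> sign) \<Rightarrow>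
     ('v, 'e, 'w, 'f) graph_map \<Rightarrow> bool" where
  "signed_graph_hom G \<sigma> H \<pi> \<phi> \<longleftrightarrow> graph_hom G H \<phi> \<and>
     (\<forall>W. closed_walk G W \<longrightarrow> walk_sign \<sigma> W = walk_sign \<pi> (walk_image \<phi> W))"

definition edge_sign_preserving_hom ::
    "('v, 'e) mgraph \<Rightarrow> ('e \<Rightarrow> sign) \<Rightarrow> ('w, 'f) mgraph \<Rightarrow> ('f \<Rightarrow> sign) \<Rightarrow>
     ('v, 'e, 'w, 'f) graph_map \<Rightarrow> bool" where
  "edge_sign_preserving_hom G \<sigma> H \<pi> \<phi> \<longleftrightarrow> graph_hom G H \<phi> \<and>
     (\<forall>e\<in>edges G. \<sigma> e = \<pi> (snd \<phi> e))"

lemma closed_walk_image: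
  assumes "graph_hom G H \<phi>" and "closed_walk G W"
  shows "closed_walk H (walk_image \<phi> W)"
proof -
  have "fst W \<noteq> []"
    using assms(2) by (auto simp: closed_walk_def is_walk_def)
  then show ?thesis
    using assms
    by (auto simp: closed_walk_def is_walk_def walk_image_def graph_hom_def hd_map last_map
        subset_iff)
qed

end

theory Submission
  imports Defs
begin

text \<open>
  Multiplying \<open>\<sigma>\<close> by the pullback of \<open>\<pi>\<close> along \<open>\<phi>\<close> gives a signature
  \<open>\<tau>\<close> of \<open>G\<close>. Signs square to \<open>1\<close>, so \<open>\<phi>\<close> preserves the signs of closed walks exactly
  when \<open>\<tau>\<close> is balanced, that is, every closed walk has \<open>\<tau>\<close>-sign \<open>1\<close>; and \<open>\<phi>\<close> preserves
  edge signs after switching \<open>X\<close> exactly when \<open>\<tau>\<close> is negative on just the edges of the cut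
  of \<open>X\<close>. The theorem thereby reduces to Harary's criterion, that a signature is balanced if and
  only if it is a cut.

  A cut is treated as a coboundary: with \<open>p\<close> the side of a vertex, written as a sign, its value
  at an edge \<open>u v\<close> is \<open>p u * p v\<close>. Such products telescope along a walk, which gives one direction
  (\<open>walk_sign_potential\<close>). Conversely, in a balanced signature all walks between two given
  vertices have the same sign; after choosing a root in each connected component, the sign of the
  walks from the root to \<open>v\<close> is a suitable \<open>p v\<close> (\<open>balanced_imp_potential\<close>).
\<close>

lemma sign_mult_self [simp]: "s * s = (1 :: sign)"
  by (simp add: times_sign_def one_sign_def)

lemma sign_mult_self_left [simp]: "s * (s * t) = (t :: sign)"
  by (simp flip: mult.assoc)

lemma sign_eq_iff_mult_eq_1: "s = t \<longleftrightarrow> s * t = (1 :: sign)"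
  by (simp add: times_sign_def one_sign_def)

lemma doubleton_mset_eq_iff:
  "{#x, y#} = {#u, v#} \<longleftrightarrow> x = u \<and> y = v \<or> x = v \<and> y = u"
  by (auto simp: add_eq_conv_diff)

lemma size_mset_2E:
  assumes "size M = 2"
  obtains u v where "M = {#u, v#}"
proof -
  from assms obtain u N where "M = add_mset u N" "size N = 1"
    using size_eq_Suc_imp_eq_union[of M 1] by (auto simp: numeral_2_eq_2)
  moreover then obtain v where "N = {#v#}"
    by (blast dest: size_1_singleton_mset)
  ultimately show ?thesis
    using that by blast
qed

lemma is_walk_Nil: "is_walk G (vs, []) \<longleftrightarrow> (\<exists>v\<in>verts G. vs = [v])"
  by (auto simp: is_walk_def length_Suc_conv)

lemma is_walk_Cons:
  "is_walk G (u # vs, e # es) \<longleftrightarrow>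
     u \<in> verts G \<and> e \<in> edges G \<and> ends G e = {#u, hd vs#} \<and> is_walk G (vs, es)"
proof -
  have "hd vs = vs ! 0" if "length vs = Suc (length es)"
    using that by (cases vs) auto
  then show ?thesis
    by (auto simp: is_walk_def less_Suc_eq_0_disj)
qed

lemma walk_sign_mult:
  "walk_sign (\<lambda>e. \<sigma> e * \<tau> e) W = walk_sign \<sigma> W * walk_sign \<tau> W"
proof -
  have "prod_list (map (\<lambda>e. \<sigma> e * \<tau> e) es)
      = prod_list (map \<sigma> es) * prod_list (map \<tau> es)" for es
    by (induction es) (simp_all add: ac_simps)
  then show ?thesis
    by (simp add: walk_sign_def)
qed

lemma walk_sign_image: "walk_sign \<pi> (walk_image \<phi> W) = walk_sign (\<lambda>e. \<pi> (snd \<phi> e)) W"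
  by (simp add: walk_sign_def walk_image_def comp_def)


section \<open>Balanced signatures and potentials\<close>

definition balanced :: "('v, 'e) mgraph \<Rightarrow> ('e \<Rightarrow> sign) \<Rightarrow> bool" where
  "balanced G \<tau> \<longleftrightarrow> (\<forall>W. closed_walk G W \<longrightarrow> walk_sign \<tau> W = 1)"

text \<open>A potential exhibits \<open>\<tau>\<close> as a coboundary on the edges of \<open>G\<close>.\<close>

definition potential :: "('v, 'e) mgraph \<Rightarrow> ('e \<Rightarrow> sign) \<Rightarrow> ('v \<Rightarrow> sign) \<Rightarrow> bool" where
  "potential G \<tau> p \<longleftrightarrow>
     (\<forall>e\<in>edges G. \<forall>u v. ends G e = {#u, v#} \<longrightarrow> \<tau> e = p u * p v)"

text \<open>The contributions of the inner vertices cancel, since each of them occurs twice.\<close>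

lemma walk_sign_potential:
  assumes "potential G \<tau> p" and "is_walk G W"
  shows "walk_sign \<tau> W = p (hd (fst W)) * p (last (fst W))"
proof -
  have "prod_list (map \<tau> es) = p (hd vs) * p (last vs)" if "is_walk G (vs, es)" for vs es
    using that
  proof (induction es arbitrary: vs)
    case Nil
    then show ?case by (auto simp: is_walk_Nil)
  next
    case (Cons e es)
    then obtain u vs' where vs: "vs = u # vs'"
      by (cases vs) (auto simp: is_walk_def)
    with Cons.prems have e: "e \<in> edges G" "ends G e = {#u, hd vs'#}"
      and W': "is_walk G (vs', es)"
      by (simp_all add: is_walk_Cons)
    have "vs' \<noteq> []" using W' by (auto simp: is_walk_def)
    moreover have "\<tau> e = p u * p (hd vs')"
      using assms(1) e by (simp add: potential_def)
    ultimately show ?case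
      using Cons.IH[OF W'] vs by (simp add: mult.assoc)
  qed
  from this[of "fst W" "snd W"] assms(2) show ?thesis
    by (simp add: walk_sign_def)
qed

lemma potential_imp_balanced: "potential G \<tau> p \<Longrightarrow> balanced G \<tau>"
  by (simp add: balanced_def closed_walk_def walk_sign_potential)

text \<open>The existence of a walk of sign \<open>s\<close> from \<open>u\<close> to \<open>v\<close>. The inductive form gives
  concatenation and reversal of walks by rule induction, without index arithmetic on lists.\<close>

inductive signed_conn :: "('v, 'e) mgraph \<Rightarrow> ('e \<Rightarrow> sign) \<Rightarrow> 'v \<Rightarrow> sign \<Rightarrow> 'v \<Rightarrow> bool"
  for G \<tau> where
  refl: "u \<in> verts G \<Longrightarrow> signed_conn G \<tau> u 1 u"
| step: "\<lbrakk>u \<in> verts G; e \<in> edges G; ends G e = {#u, v#}; signed_conn G \<tau> v s w\<rbrakk>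
    \<Longrightarrow> signed_conn G \<tau> u (\<tau> e * s) w"

lemma signed_conn_in_verts:
  "signed_conn G \<tau> u s v \<Longrightarrow> u \<in> verts G \<and> v \<in> verts G"
  by (induction rule: signed_conn.induct) auto

lemma signed_conn_imp_walk:
  assumes "signed_conn G \<tau> u s v"
  obtains W where "is_walk G W" "hd (fst W) = u" "last (fst W) = v" "walk_sign \<tau> W = s"
proof -
  have "\<exists>vs es. is_walk G (vs, es) \<and> hd vs = u \<and> last vs = v \<and> prod_list (map \<tau> es) = s"
    using assms
  proof induction
    case (refl u)
    then show ?case by (intro exI[of _ "[u]"] exI[of _ "[]"]) (simp add: is_walk_Nil)
  next
    case (step u e v s w)
    then obtain vs es where W: "is_walk G (vs, es)" "hd vs = v" "last vs = w"
        "prod_list (map \<tau> es) = s"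
      by blast
    then have "vs \<noteq> []" by (auto simp: is_walk_def)
    with W step.hyps show ?case
      by (intro exI[of _ "u # vs"] exI[of _ "e # es"]) (simp add: is_walk_Cons)
  qed
  then show ?thesis
    using that by (auto simp: walk_sign_def)
qed

lemma signed_conn_edge:
  assumes "u \<in> verts G" "v \<in> verts G" "e \<in> edges G" "ends G e = {#u, v#}"
  shows "signed_conn G \<tau> u (\<tau> e) v"
  using signed_conn.step[OF assms(1,3,4) signed_conn.refl[OF assms(2)]] by simp

lemma signed_conn_trans:
  "signed_conn G \<tau> u s v \<Longrightarrow> signed_conn G \<tau> v t w \<Longrightarrow> signed_conn G \<tau> u (s * t) w"
  by (induction rule: signed_conn.induct) (auto simp: mult.assoc intro: signed_conn.step)

lemma signed_conn_sym:
  "signed_conn G \<tau> u s v \<Longrightarrow> signed_conn G \<tau> v s u"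
proof (induction rule: signed_conn.induct)
  case (refl u)
  then show ?case by (rule signed_conn.refl)
next
  case (step u e v s w)
  have "v \<in> verts G"
    using signed_conn_in_verts[OF step.hyps(4)] by simp
  moreover have "ends G e = {#v, u#}"
    using step.hyps(3) by (simp add: doubleton_mset_eq_iff)
  ultimately have "signed_conn G \<tau> v (\<tau> e) u"
    using step.hyps(1,2) by (intro signed_conn_edge)
  from signed_conn_trans[OF step.IH this] show ?case
    by (simp add: mult.commute)
qed

text \<open>Following one walk and returning along the other gives a closed walk.\<close>

lemma balanced_signed_conn_unique:
  assumes "balanced G \<tau>" "signed_conn G \<tau> u s v" "signed_conn G \<tau> u t v"
  shows "s = t"
proof -
  have "signed_conn G \<tau> u (s * t) u"
    using assms(2) signed_conn_sym[OF assms(3)] by (rule signed_conn_trans)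
  then obtain W where "is_walk G W" "hd (fst W) = u" "last (fst W) = u" "walk_sign \<tau> W = s * t"
    by (rule signed_conn_imp_walk)
  then have "closed_walk G W" "walk_sign \<tau> W = s * t"
    by (simp_all add: closed_walk_def)
  with assms(1) have "s * t = 1"
    unfolding balanced_def by metis
  then show ?thesis
    by (rule sign_eq_iff_mult_eq_1[THEN iffD2])
qed

text \<open>The potential of a vertex is the sign of the walks to it from the root of its component.\<close>

lemma balanced_imp_potential:
  assumes "multigraph G" and "balanced G \<tau>"
  obtains p where "potential G \<tau> p"
proof
  define root where "root v = (SOME r. \<exists>s. signed_conn G \<tau> r s v)" for v
  define p where "p v = (SOME s. signed_conn G \<tau> (root v) s v)" for v
  have p: "signed_conn G \<tau> (root v) (p v) v" if "v \<in> verts G" for v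
  proof -
    have "\<exists>r s. signed_conn G \<tau> r s v"
      using signed_conn.refl[OF that, of \<tau>] by blast
    then have "\<exists>s. signed_conn G \<tau> (root v) s v"
      unfolding root_def by (rule someI_ex)
    then show ?thesis
      unfolding p_def by (rule someI_ex)
  qed
  have *: "\<tau> e = p u * p v" if e: "e \<in> edges G" and uv: "ends G e = {#u, v#}" for e u v
  proof -
    have verts: "u \<in> verts G" "v \<in> verts G"
      using assms(1) e uv by (auto simp: multigraph_def)
    have conn: "signed_conn G \<tau> u (\<tau> e) v"
      using verts e uv by (rule signed_conn_edge)
    (* Adjacent vertices have equal sets of candidate roots, hence the same chosen root. *)
    have "(\<exists>s. signed_conn G \<tau> r s u) \<longleftrightarrow> (\<exists>s. signed_conn G \<tau> r s v)" for r
      using signed_conn_trans[OF _ conn] signed_conn_trans[OF _ signed_conn_sym[OF conn]] by metis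
    then have "root u = root v"
      by (simp add: root_def)
    then have "signed_conn G \<tau> (root v) (p u * \<tau> e) v"
      using signed_conn_trans[OF p[OF verts(1)] conn] by simp
    then have "p u * \<tau> e = p v"
      using p[OF verts(2)] by (rule balanced_signed_conn_unique[OF assms(2)])
    then show ?thesis
      by (metis sign_mult_self_left)
  qed
  show "potential G \<tau> p"
    unfolding potential_def by (blast intro: *)
qed


section \<open>Switching\<close>

definition side :: "'v set \<Rightarrow> 'v \<Rightarrow> sign" where
  "side X v = (if v \<in> X then Neg else Pos)"

lemma switch_eq_side:
  assumes "multigraph G" "e \<in> edges G" "ends G e = {#u, v#}"
  shows "switch G X \<sigma> e = side X u * side X v * \<sigma> e"
proof -
  have verts: "u \<in> verts G" "v \<in> verts G"
    using assms by (auto simp: multigraph_def)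
  (* Either orientation of the edge may witness the condition in the definition of switching. *)
  have "(\<exists>x y. ends G e = {#x, y#} \<and> x \<in> X \<and> y \<in> verts G - X) \<longleftrightarrow> (u \<in> X) \<noteq> (v \<in> X)"
    using assms(3) verts by (auto simp: doubleton_mset_eq_iff)
  then show ?thesis
    by (cases "\<sigma> e") (auto simp: switch_def side_def times_sign_def uminus_sign_def)
qed

text \<open>Switching multiplies a signature by the coboundary of \<open>side X\<close>, so it turns \<open>\<sigma>\<close> into
  \<open>\<rho>\<close> exactly when \<open>side X\<close> is a potential of the product of \<open>\<sigma>\<close> and \<open>\<rho>\<close>. On the
  vertices of \<open>G\<close> every \<open>p\<close> has the form \<open>side X\<close>, with \<open>X\<close> the set where it is negative.\<close>

lemma ex_switching_eq_iff_potential: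
  assumes "multigraph G"
  shows "(\<exists>\<sigma>'. is_switching G \<sigma> \<sigma>' \<and> (\<forall>e\<in>edges G. \<sigma>' e = \<rho> e))
    \<longleftrightarrow> (\<exists>p. potential G (\<lambda>e. \<sigma> e * \<rho> e) p)"
proof
  assume "\<exists>\<sigma>'. is_switching G \<sigma> \<sigma>' \<and> (\<forall>e\<in>edges G. \<sigma>' e = \<rho> e)"
  then obtain X where X: "\<rho> e = switch G X \<sigma> e" if "e \<in> edges G" for e
    unfolding is_switching_def by metis
  have "potential G (\<lambda>e. \<sigma> e * \<rho> e) (side X)"
    unfolding potential_def
  proof (intro ballI allI impI)
    fix e u v
    assume e: "e \<in> edges G" and uv: "ends G e = {#u, v#}"
    have "\<rho> e = side X u * side X v * \<sigma> e"
      using X[OF e] switch_eq_side[OF assms e uv] by simp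
    then show "\<sigma> e * \<rho> e = side X u * side X v"
      by (simp add: mult.commute)
  qed
  then show "\<exists>p. potential G (\<lambda>e. \<sigma> e * \<rho> e) p"
    by blast
next
  assume "\<exists>p. potential G (\<lambda>e. \<sigma> e * \<rho> e) p"
  then obtain p where p: "potential G (\<lambda>e. \<sigma> e * \<rho> e) p" ..
  define X where "X = {v \<in> verts G. p v = Neg}"
  have side: "side X v = p v" if "v \<in> verts G" for v
    using that by (cases "p v") (auto simp: side_def X_def)
  have "switch G X \<sigma> e = \<rho> e" if e: "e \<in> edges G" for e
  proof -
    have "size (ends G e) = 2"
      using assms e by (simp add: multigraph_def)
    then obtain u v where uv: "ends G e = {#u, v#}"
      by (rule size_mset_2E)
    then have "u \<in> verts G" "v \<in> verts G"
      using assms e by (auto simp: multigraph_def)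
    then have "switch G X \<sigma> e = p u * p v * \<sigma> e"
      using switch_eq_side[OF assms e uv] by (simp add: side)
    also have "p u * p v = \<sigma> e * \<rho> e"
      using p e uv by (simp add: potential_def)
    also have "\<sigma> e * \<rho> e * \<sigma> e = \<rho> e"
      by (simp add: mult.commute[of _ "\<sigma> e"])
    finally show ?thesis .
  qed
  then have "is_switching G \<sigma> (switch G X \<sigma>) \<and> (\<forall>e\<in>edges G. switch G X \<sigma> e = \<rho> e)"
    unfolding is_switching_def by (intro conjI exI[of _ X]) (simp_all add: X_def)
  then show "\<exists>\<sigma>'. is_switching G \<sigma> \<sigma>' \<and> (\<forall>e\<in>edges G. \<sigma>' e = \<rho> e)"
    by blast
qed

theorem theorem14:
  fixes G :: "('v, 'e) mgraph" and \<sigma> :: "'e \<Rightarrow> sign"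
    and H :: "('w, 'f) mgraph" and \<pi> :: "'f \<Rightarrow> sign"
    and \<phi> :: "('v, 'e, 'w, 'f) graph_map"
  assumes "multigraph G" and "multigraph H" and "graph_hom G H \<phi>"
  shows "signed_graph_hom G \<sigma> H \<pi> \<phi> \<longleftrightarrow>
    (\<exists>\<sigma>'. is_switching G \<sigma> \<sigma>' \<and> edge_sign_preserving_hom G \<sigma>' H \<pi> \<phi>)"
proof -
  define \<tau> where "\<tau> = (\<lambda>e. \<sigma> e * \<pi> (snd \<phi> e))"
  have "signed_graph_hom G \<sigma> H \<pi> \<phi> \<longleftrightarrow> balanced G \<tau>"
    using assms(3)
    by (simp add: signed_graph_hom_def balanced_def \<tau>_def walk_sign_mult walk_sign_image
        sign_eq_iff_mult_eq_1[of "walk_sign _ _" "walk_sign _ _"])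
  also have "\<dots> \<longleftrightarrow> (\<exists>p. potential G \<tau> p)"
    using assms(1) by (auto elim: balanced_imp_potential intro: potential_imp_balanced)
  also have "\<dots> \<longleftrightarrow> (\<exists>\<sigma>'. is_switching G \<sigma> \<sigma>' \<and> edge_sign_preserving_hom G \<sigma>' H \<pi> \<phi>)"
    using ex_switching_eq_iff_potential[OF assms(1), of \<sigma> "\<lambda>e. \<pi> (snd \<phi> e)"] assms(3)
    by (simp add: edge_sign_preserving_hom_def \<tau>_def)
  finally show ?thesis .
qed

end
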